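(* Let $E,F$ be complex Banach spaces, $U\subseteq E$ open, $v$ a weight on $U$, and $p\in(1,\infty)$. If $f\in\mathcal H^\infty_{v\mathcal K_{wp}}(U,F)$, then $f^t\in\mathcal{QN}_{wp}(F^*,\mathcal H_v^\infty(U))$ and $\|f^t\|_{\mathcal{QN}_{wp}}\le\|f\|_{\mathcal H^\infty_{v\mathcal K_{wp}}}$.
   Context: A weight on $U$ is a strictly positive continuous function. $\mathcal H_v^\infty(U,F)$ is the Banach space of holomorphic $f\colon U\to F$ with $\|f\|_v:=\sup_{x\in U}v(x)\|f(x)\|<\infty$; $\mathcal H_v^\infty(U):=\mathcal H_v^\infty(U,\mathbb C)$. The transpose of $f\in\mathcal H_v^\infty(U,F)$ is the bounded linear operator $f^t\colon F^*\to\mathcal H_v^\infty(U)$, $f^t(y^* )=y^*\circ f$. $p^*$ is the conjugate index of $p$. For a Banach space $X$, $\ell_p^w(X)$ is the space of sequences in $X$ with $\|(x_n)\|_p^w=\sup_{x^*\in B_{X^*}}(\sum|x^*(x_n)|^p)^{1/p}<\infty$, and $p\text{-}\mathrm{conv}(x_n)=\{\sum_n a_nx_n:(a_n)\in B_{\ell_{p^*}}\}$. A set $K\subseteq X$ is relatively weakly $p$-compact if $K\subseteq p\text{-}\mathrm{conv}(x_n)$ for some $(x_n)\in\ell_p^w(X)$, and $m_{\mathcal K_{wp}}(K)$ is the infimum of $\|(x_n)\|_p^w$ over all such sequences. $\mathcal H^\infty_{v\mathcal K_{wp}}(U,F)$ is the set of $f\in\mathcal H_v^\infty(U,F)$ such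 that $(vf)(U)=\{v(x)f(x):x\in U\}$ is relatively weakly $p$-compact, with $\|f\|_{\mathcal H^\infty_{v\mathcal K_{wp}}}=m_{\mathcal K_{wp}}((vf)(U))$. A bounded linear operator $T\colon X\to Y$ is quasi weakly $p$-nuclear, $T\in\mathcal{QN}_{wp}(X,Y)$, if there is $(x_n^* )\in\ell_p^w(X^* )$ with $\|T(x)\|\le(\sum_n|x_n^*(x)|^p)^{1/p}$ for all $x\in X$; $\|T\|_{\mathcal{QN}_{wp}}$ is the infimum of $\|(x_n^* )\|_p^w$ over all such sequences. *)

theory Defs
  imports "HOL-Analysis.Analysis" "HOL-Library.Function_Algebras"
begin

class complex_vector = ab_group_add +
  fixes scaleC :: "complex \<Rightarrow> 'a \<Rightarrow> 'a" (infixr "*\<^sub>C" 75)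
  assumes scaleC_add_right: "a *\<^sub>C (x + y) = a *\<^sub>C x + a *\<^sub>C y"
    and scaleC_add_left: "(a + b) *\<^sub>C x = a *\<^sub>C x + b *\<^sub>C x"
    and scaleC_scaleC: "a *\<^sub>C b *\<^sub>C x = (a * b) *\<^sub>C x"
    and scaleC_one: "1 *\<^sub>C x = x"

text \<open>The underlying real normed space is the one of the library, so that the library's topology,
  Fr\'echet derivatives, series and completeness are available.\<close>

class complex_normed_vector = complex_vector + real_normed_vector +
  assumes scaleR_scaleC: "r *\<^sub>R x = complex_of_real r *\<^sub>C x"
    and norm_scaleC: "norm (a *\<^sub>C x) = cmod a * norm x"

class complex_banach = complex_normed_vector + banach

instantiation complex :: complex_banach
begin

definition scaleC_complex :: "complex \<Rightarrow> complex \<Rightarrow> complex"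
  where "scaleC_complex a x = a * x"

instance
  by standard (simp_all add: scaleC_complex_def algebra_simps norm_mult scaleR_conv_of_real)

end

text \<open>Pointwise structure on functions; the spaces of holomorphic functions below are linear
  subspaces of such function types.\<close>

instantiation "fun" :: (type, complex_vector) complex_vector
begin

definition scaleC_fun :: "complex \<Rightarrow> ('a \<Rightarrow> 'b) \<Rightarrow> 'a \<Rightarrow> 'b"
  where "scaleC_fun c f = (\<lambda>x. c *\<^sub>C f x)"

instance
  by standard (simp_all add: scaleC_fun_def fun_eq_iff scaleC_add_right scaleC_add_left
      scaleC_scaleC scaleC_one)

end

typedef (overloaded) ('a::complex_normed_vector) cdual =
  "{f :: 'a \<Rightarrow>\<^sub>L complex. \<forall>c x. blinfun_apply f (c *\<^sub>C x) = c * blinfun_apply f x}"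
  morphisms blinfun_of_cdual Abs_cdual
  by (rule exI[of _ 0]) simp

setup_lifting type_definition_cdual

lift_definition cdual_apply :: "'a::complex_normed_vector cdual \<Rightarrow> 'a \<Rightarrow> complex"
  is blinfun_apply .

text \<open>The norm is inherited from the bounded real-linear maps, i.e.\ it is the operator norm.\<close>

instantiation cdual :: (complex_normed_vector) complex_normed_vector
begin

lift_definition norm_cdual :: "'a cdual \<Rightarrow> real" is norm .

lift_definition zero_cdual :: "'a cdual" is 0 by simp

lift_definition plus_cdual :: "'a cdual \<Rightarrow> 'a cdual \<Rightarrow> 'a cdual" is "(+)"
  by (simp add: blinfun.add_left algebra_simps)

lift_definition minus_cdual :: "'a cdual \<Rightarrow> 'a cdual \<Rightarrow> 'a cdual" is "(-)"
  by (simp add: blinfun.diff_left algebra_simps)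

lift_definition uminus_cdual :: "'a cdual \<Rightarrow> 'a cdual" is uminus
  by (simp add: blinfun.minus_left)

lift_definition scaleR_cdual :: "real \<Rightarrow> 'a cdual \<Rightarrow> 'a cdual" is "(*\<^sub>R)"
  by (simp add: blinfun.scaleR_left)

lift_definition scaleC_cdual :: "complex \<Rightarrow> 'a cdual \<Rightarrow> 'a cdual"
  is "\<lambda>c f. blinfun_compose (blinfun_mult_right c) f"
  by simp

definition dist_cdual :: "'a cdual \<Rightarrow> 'a cdual \<Rightarrow> real"
  where "dist_cdual f g = norm (f - g)"

definition sgn_cdual :: "'a cdual \<Rightarrow> 'a cdual"
  where "sgn_cdual f = inverse (norm f) *\<^sub>R f"

definition uniformity_cdual :: "('a cdual \<times> 'a cdual) filter"
  where "uniformity_cdual = (INF e\<in>{0 <..}. principal {(x, y). dist x y < e})"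

definition open_cdual :: "'a cdual set \<Rightarrow> bool"
  where "open_cdual S = (\<forall>x\<in>S. \<forall>\<^sub>F (x', y) in uniformity. x' = x \<longrightarrow> y \<in> S)"

instance
proof
  fix f g h :: "'a cdual" and r s :: real and a b :: complex
  show "a *\<^sub>C (f + g) = a *\<^sub>C f + a *\<^sub>C g"
    by transfer (rule blinfun_eqI, simp add: blinfun.add_left algebra_simps)
  show "(a + b) *\<^sub>C f = a *\<^sub>C f + b *\<^sub>C f"
    by transfer (rule blinfun_eqI, simp add: blinfun.add_left algebra_simps)
  show "a *\<^sub>C b *\<^sub>C f = (a * b) *\<^sub>C f"
    by transfer (rule blinfun_eqI, simp)
  show "1 *\<^sub>C f = f"
    by transfer (rule blinfun_eqI, simp)
  show "r *\<^sub>R f = complex_of_real r *\<^sub>C f"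
    by transfer (rule blinfun_eqI, simp add: blinfun.scaleR_left scaleR_conv_of_real)
  show "norm (a *\<^sub>C f) = cmod a * norm f"
  proof transfer
    fix a and f :: "'a \<Rightarrow>\<^sub>L complex"
    have le: "norm (blinfun_compose (blinfun_mult_right c) g) \<le> cmod c * norm g"
      for c and g :: "'a \<Rightarrow>\<^sub>L complex"
      by (rule norm_blinfun_bound)
        (simp_all add: norm_mult mult.assoc mult_left_mono norm_blinfun)
    show "norm (blinfun_compose (blinfun_mult_right a) f) = cmod a * norm f"
    proof (cases "a = 0")
      case True
      then show ?thesis using le[of a f] by simp
    next
      case False
      have "f = blinfun_compose (blinfun_mult_right (inverse a)) (blinfun_compose (blinfun_mult_right a) f)"
        by (rule blinfun_eqI) (simp add: False)
      then have "norm f \<le> cmod (inverse a) * norm (blinfun_compose (blinfun_mult_right a) f)"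
        using le by metis
      then have "cmod a * norm f \<le> norm (blinfun_compose (blinfun_mult_right a) f)"
        using False by (simp add: norm_inverse norm_divide field_simps)
      with le[of a f] show ?thesis by simp
    qed
  qed
  show "dist f g = norm (f - g)" by (rule dist_cdual_def)
  show "sgn f = inverse (norm f) *\<^sub>R f" by (rule sgn_cdual_def)
  show "(uniformity :: ('a cdual \<times> 'a cdual) filter) = (INF e\<in>{0 <..}. principal {(x, y). dist x y < e})"
    by (rule uniformity_cdual_def)
  show "open S = (\<forall>x\<in>S. \<forall>\<^sub>F (x', y) in uniformity. x' = x \<longrightarrow> y \<in> S)" for S :: "'a cdual set"
    by (rule open_cdual_def)
  show "f + g + h = f + (g + h)" by transfer simp
  show "f + g = g + f" by transfer simp
  show "0 + f = f" by transfer simp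
  show "- f + f = 0" by transfer simp
  show "f - g = f + - g" by transfer simp
  show "r *\<^sub>R (f + g) = r *\<^sub>R f + r *\<^sub>R g" by transfer (simp add: scaleR_add_right)
  show "(r + s) *\<^sub>R f = r *\<^sub>R f + s *\<^sub>R f" by transfer (simp add: scaleR_add_left)
  show "r *\<^sub>R s *\<^sub>R f = (r * s) *\<^sub>R f" by transfer simp
  show "1 *\<^sub>R f = f" by transfer simp
  show "(norm f = 0) = (f = 0)" by transfer simp
  show "norm (f + g) \<le> norm f + norm g" by transfer (rule norm_triangle_ineq)
  show "norm (r *\<^sub>R f) = \<bar>r\<bar> * norm f" by transfer simp
qed

end

instance cdual :: (complex_normed_vector) complex_banach
proof
  fix X :: "nat \<Rightarrow> 'a cdual"
  assume X: "Cauchy X"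
  have dist: "dist (blinfun_of_cdual f) (blinfun_of_cdual g) = dist f g" for f g :: "'a cdual"
    by (simp add: dist_norm norm_cdual.rep_eq minus_cdual.rep_eq)
  have "Cauchy (\<lambda>n. blinfun_of_cdual (X n))"
    using X by (simp add: Cauchy_def dist)
  then obtain l where l: "(\<lambda>n. blinfun_of_cdual (X n)) \<longlonglongrightarrow> l"
    using Cauchy_convergent convergent_def by blast
  have lim: "(\<lambda>n. blinfun_apply (blinfun_of_cdual (X n)) x) \<longlonglongrightarrow> blinfun_apply l x" for x
    using l by (intro tendsto_intros)
  have "blinfun_apply l (c *\<^sub>C x) = c * blinfun_apply l x" for c x
  proof (rule LIMSEQ_unique[OF lim])
    have "blinfun_apply (blinfun_of_cdual (X n)) (c *\<^sub>C x) = c * blinfun_apply (blinfun_of_cdual (X n)) x" for n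
      using blinfun_of_cdual[of "X n"] by simp
    then show "(\<lambda>n. blinfun_apply (blinfun_of_cdual (X n)) (c *\<^sub>C x)) \<longlonglongrightarrow> c * blinfun_apply l x"
      by (simp add: tendsto_mult_left lim)
  qed
  then have "blinfun_of_cdual (Abs_cdual l) = l"
    by (simp add: Abs_cdual_inverse)
  then have "X \<longlonglongrightarrow> Abs_cdual l"
    using l by (simp add: lim_sequentially flip: dist)
  then show "convergent X"
    by (auto simp: convergent_def)
qed

text \<open>All notions depending on \<open>p\<close> are meant for \<^term>\<open>1 < (p::real)\<close>.\<close>

definition lp :: "real \<Rightarrow> (nat \<Rightarrow> complex) set"
  where "lp p = {a. summable (\<lambda>n. cmod (a n) powr p)}"

definition lp_norm :: "real \<Rightarrow> (nat \<Rightarrow> complex) \<Rightarrow> real"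
  where "lp_norm p a = (\<Sum>n. cmod (a n) powr p) powr (1 / p)"

definition conj_index :: "real \<Rightarrow> real"
  where "conj_index p = p / (p - 1)"

text \<open>Membership in \<^term>\<open>lp\<close> and boundedness express that the supremum is finite; only on this set
  does the real-valued supremum \<open>weak_lp_norm\<close> have its intended meaning.\<close>

definition weak_lp :: "real \<Rightarrow> (nat \<Rightarrow> 'x::complex_normed_vector) set"
  where "weak_lp p = {xs.
    (\<forall>\<phi> \<in> cball (0 :: 'x cdual) 1. (\<lambda>n. cdual_apply \<phi> (xs n)) \<in> lp p) \<and>
    bdd_above ((\<lambda>\<phi>. lp_norm p (\<lambda>n. cdual_apply \<phi> (xs n))) ` cball (0 :: 'x cdual) 1)}"

definition weak_lp_norm :: "real \<Rightarrow> (nat \<Rightarrow> 'x::complex_normed_vector) \<Rightarrow> real"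
  where "weak_lp_norm p xs =
    (SUP \<phi> \<in> cball (0 :: 'x cdual) 1. lp_norm p (\<lambda>n. cdual_apply \<phi> (xs n)))"

definition p_conv :: "real \<Rightarrow> (nat \<Rightarrow> 'x::complex_normed_vector) \<Rightarrow> 'x set"
  where "p_conv p xs =
    {y. \<exists>a \<in> lp (conj_index p). lp_norm (conj_index p) a \<le> 1 \<and> (\<lambda>n. a n *\<^sub>C xs n) sums y}"

definition rel_weakly_p_compact :: "real \<Rightarrow> 'x::complex_normed_vector set \<Rightarrow> bool"
  where "rel_weakly_p_compact p K \<longleftrightarrow> (\<exists>xs \<in> weak_lp p. K \<subseteq> p_conv p xs)"

definition m_Kwp :: "real \<Rightarrow> 'x::complex_normed_vector set \<Rightarrow> real"
  where "m_Kwp p K = Inf {weak_lp_norm p xs | xs. xs \<in> weak_lp p \<and> K \<subseteq> p_conv p xs}"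

definition weight_on :: "'e::topological_space set \<Rightarrow> ('e \<Rightarrow> real) \<Rightarrow> bool"
  where "weight_on U v \<longleftrightarrow> continuous_on U v \<and> (\<forall>x\<in>U. v x > 0)"

text \<open>Holomorphic means complex Fr\'echet differentiable at every point; on open sets this agrees
  with the definition through local power series.\<close>

definition holomorphic_map_on ::
  "'e set \<Rightarrow> ('e::complex_normed_vector \<Rightarrow> 'f::complex_normed_vector) \<Rightarrow> bool"
  where "holomorphic_map_on U f \<longleftrightarrow>
    (\<forall>x\<in>U. \<exists>D. (f has_derivative D) (at x) \<and> (\<forall>c h. D (c *\<^sub>C h) = c *\<^sub>C D h))"

text \<open>A map \<open>U \<rightarrow> F\<close> is represented by its extension by zero, so that \<open>weighted_norm U v\<close> is
  a norm and not only a seminorm on \<open>Hv U v\<close>. Inserting \<open>0\<close> only matters for empty \<open>U\<close>.\<close>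

definition weighted_norm :: "'e set \<Rightarrow> ('e \<Rightarrow> real) \<Rightarrow> ('e \<Rightarrow> 'f::real_normed_vector) \<Rightarrow> real"
  where "weighted_norm U v f = Sup (insert 0 ((\<lambda>x. v x * norm (f x)) ` U))"

definition Hv :: "'e set \<Rightarrow> ('e \<Rightarrow> real) \<Rightarrow> ('e::complex_normed_vector \<Rightarrow> 'f::complex_normed_vector) set"
  where "Hv U v = {f. holomorphic_map_on U f \<and> bdd_above ((\<lambda>x. v x * norm (f x)) ` U) \<and>
    (\<forall>x. x \<notin> U \<longrightarrow> f x = 0)}"

definition HvKwp ::
  "real \<Rightarrow> 'e set \<Rightarrow> ('e \<Rightarrow> real) \<Rightarrow> ('e::complex_normed_vector \<Rightarrow> 'f::complex_normed_vector) set"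
  where "HvKwp p U v = {f \<in> Hv U v. rel_weakly_p_compact p ((\<lambda>x. v x *\<^sub>R f x) ` U)}"

definition HvKwp_norm ::
  "real \<Rightarrow> 'e set \<Rightarrow> ('e \<Rightarrow> real) \<Rightarrow> ('e \<Rightarrow> 'f::complex_normed_vector) \<Rightarrow> real"
  where "HvKwp_norm p U v f = m_Kwp p ((\<lambda>x. v x *\<^sub>R f x) ` U)"

definition transpose_map :: "('e \<Rightarrow> 'f::complex_normed_vector) \<Rightarrow> 'f cdual \<Rightarrow> 'e \<Rightarrow> complex"
  where "transpose_map f = (\<lambda>y. cdual_apply y \<circ> f)"

text \<open>Since \<open>Hv U v\<close> depends on the terms \<open>U\<close> and \<open>v\<close>, it is not a type. The codomain of an
  operator is therefore given as a linear subspace \<open>Y\<close> of a complex vector space together with a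
  norm \<open>N\<close> on \<open>Y\<close>.\<close>

definition bounded_clinear_into ::
  "'y set \<Rightarrow> ('y \<Rightarrow> real) \<Rightarrow> ('x::complex_normed_vector \<Rightarrow> 'y::complex_vector) \<Rightarrow> bool"
  where "bounded_clinear_into Y N T \<longleftrightarrow>
    (\<forall>x. T x \<in> Y) \<and>
    (\<forall>x x'. T (x + x') = T x + T x') \<and>
    (\<forall>c x. T (c *\<^sub>C x) = c *\<^sub>C T x) \<and>
    (\<exists>C. \<forall>x. N (T x) \<le> C * norm x)"

definition QNwp_dominating ::
  "real \<Rightarrow> ('y \<Rightarrow> real) \<Rightarrow> ('x::complex_normed_vector \<Rightarrow> 'y) \<Rightarrow> (nat \<Rightarrow> 'x cdual) set"
  where "QNwp_dominating p N T =
    {xs \<in> weak_lp p. \<forall>x. N (T x) \<le> (\<Sum>n. cmod (cdual_apply (xs n) x) powr p) powr (1 / p)}"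

definition QNwp ::
  "real \<Rightarrow> 'y set \<Rightarrow> ('y \<Rightarrow> real) \<Rightarrow> ('x::complex_normed_vector \<Rightarrow> 'y::complex_vector) set"
  where "QNwp p Y N = {T. bounded_clinear_into Y N T \<and> QNwp_dominating p N T \<noteq> {}}"

definition QNwp_norm ::
  "real \<Rightarrow> ('y \<Rightarrow> real) \<Rightarrow> ('x::complex_normed_vector \<Rightarrow> 'y) \<Rightarrow> real"
  where "QNwp_norm p N T = Inf (weak_lp_norm p ` QNwp_dominating p N T)"

end

theory Submission
  imports Defs
begin

text \<open>The canonical embedding \<open>\<iota>\<close> of \<open>F\<close> into \<open>F\<^sup>*\<^sup>*\<close> sends a weakly \<open>p\<close>-summable sequence
  \<open>(x\<^sub>n)\<close> to a weakly \<open>p\<close>-summable sequence of no larger norm, because \<open>\<phi> \<circ> \<iota>\<close> lies in the unit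
  ball of \<open>F\<^sup>*\<close> whenever \<open>\<phi>\<close> lies in that of \<open>F\<^sup>*\<^sup>*\<^sup>*\<close>. If moreover \<open>(vf)(U)\<close> is contained in the
  \<open>p\<close>-convex hull of \<open>(x\<^sub>n)\<close>, then Hoelder's inequality gives
  \<open>v(x) |y(f(x))| = |\<Sum> a\<^sub>n y(x\<^sub>n)| \<le> (\<Sum> |y(x\<^sub>n)|\<^sup>p)\<^sup>1\<^sup>/\<^sup>p\<close>, so that \<open>(\<iota>(x\<^sub>n))\<close> dominates the
  transpose of \<open>f\<close>.\<close>

section \<open>Hoelder's inequality for series of nonnegative reals\<close>

lemma
  fixes a b :: "nat \<Rightarrow> real"
  assumes p: "1 < p" and q: "1 < q" and pq: "1 / p + 1 / q = 1"
    and a: "\<And>n. 0 \<le> a n" and b: "\<And>n. 0 \<le> b n"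
    and sa: "summable (\<lambda>n. a n powr p)" and sb: "summable (\<lambda>n. b n powr q)"
  shows summable_Holder: "summable (\<lambda>n. a n * b n)"
    and suminf_Holder:
      "(\<Sum>n. a n * b n) \<le> (\<Sum>n. a n powr p) powr (1 / p) * (\<Sum>n. b n powr q) powr (1 / q)"
proof -
  \<comment> \<open>Young's inequality in unnormalised form is only strong enough for summability;
    the sharp constant comes from normalising below.\<close>
  have young: "a n * b n \<le> a n powr p / p + b n powr q / q" for n
    using Youngs_inequality[OF p q pq a b] .
  show sab: "summable (\<lambda>n. a n * b n)"
    by (rule summable_comparison_test'[of "\<lambda>n. a n powr p / p + b n powr q / q" 0])
      (auto intro!: summable_add summable_divide sa sb simp: a b young)
  define A where "A = (\<Sum>n. a n powr p) powr (1 / p)"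
  define B where "B = (\<Sum>n. b n powr q) powr (1 / q)"
  have A0: "0 \<le> A" and B0: "0 \<le> B" by (auto simp: A_def B_def)
  have Ap: "A powr p = (\<Sum>n. a n powr p)"
    using p sa by (simp add: A_def powr_powr suminf_nonneg)
  have Bq: "B powr q = (\<Sum>n. b n powr q)"
    using q sb by (simp add: B_def powr_powr suminf_nonneg)
  have "(\<Sum>n. a n * b n) \<le> A * B"
  \<comment> \<open>Normalising divides by \<open>A\<close> and \<open>B\<close>. If one of them is
    zero, the corresponding sequence vanishes identically, and so does the product.\<close>
  proof (cases "A = 0 \<or> B = 0")
    case True
    then have "(\<forall>n. a n = 0) \<or> (\<forall>n. b n = 0)"
      using Ap Bq suminf_eq_zero_iff[OF sa] suminf_eq_zero_iff[OF sb] p q by force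
    then have "(\<Sum>n. a n * b n) = 0" by auto
    then show ?thesis using A0 B0 by simp
  next
    case False
    with A0 B0 have A: "0 < A" and B: "0 < B" by auto
    \<comment> \<open>Young's inequality for the normalised sequences \<open>a n / A\<close> and
      \<open>b n / B\<close>. Their powers sum to 1 each, so the right-hand sides add up to
      \<open>1 / p + 1 / q = 1\<close>.\<close>
    have "a n * b n / (A * B) \<le> a n powr p / A powr p / p + b n powr q / B powr q / q" for n
      using Youngs_inequality[OF p q pq, of "a n / A" "b n / B"] a b A B
      by (simp add: powr_divide)
    then have "(\<Sum>n. a n * b n / (A * B)) \<le>
        (\<Sum>n. a n powr p / A powr p / p + b n powr q / B powr q / q)"
      by (intro suminf_le summable_add summable_divide sa sb sab) auto
    also have "\<dots> = (\<Sum>n. a n powr p) / A powr p / p + (\<Sum>n. b n powr q) / B powr q / q"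
      by (intro sums_unique[symmetric] sums_add sums_divide summable_sums sa sb)
    also have "\<dots> = 1"
      using A B pq by (simp flip: Ap Bq)
    finally show ?thesis
      using A B sab by (simp add: suminf_divide divide_le_eq)
  qed
  then show "(\<Sum>n. a n * b n) \<le>
      (\<Sum>n. a n powr p) powr (1 / p) * (\<Sum>n. b n powr q) powr (1 / q)"
    by (simp only: A_def B_def)
qed

section \<open>Dual spaces and the embedding into the bidual\<close>

lemma bounded_linear_cdual_apply: "bounded_linear (cdual_apply y)"
  by transfer (rule blinfun.bounded_linear_right)

lemma cdual_apply_scaleC: "cdual_apply y (c *\<^sub>C x) = c * cdual_apply y x"
  by transfer simp

lemma norm_cdual_apply_le: "cmod (cdual_apply y x) \<le> norm y * norm x"
  by transfer (rule norm_blinfun)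

lemma cdual_apply_add_left: "cdual_apply (y + z) x = cdual_apply y x + cdual_apply z x"
  by transfer (simp add: blinfun.add_left)

lemma cdual_apply_scaleC_left: "cdual_apply (c *\<^sub>C y) x = c * cdual_apply y x"
  by transfer simp

lemma cdual_apply_zero_left: "cdual_apply 0 x = 0"
  by transfer simp

text \<open>Serves twice: to realise evaluation at a point as an element of the bidual, and to pull
  a functional on the bidual back to the original space. The norm bound is what keeps the pullback
  in the unit ball.\<close>

lemma cdual_existence:
  fixes g :: "'a::complex_normed_vector \<Rightarrow> complex"
  assumes add: "\<And>x y. g (x + y) = g x + g y"
    and scale: "\<And>c x. g (c *\<^sub>C x) = c * g x"
    and bound: "\<And>x. cmod (g x) \<le> K * norm x" and K: "0 \<le> K"
  shows "\<exists>y. (\<forall>x. cdual_apply y x = g x) \<and> norm y \<le> K"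
proof -
  have g: "bounded_linear g"
    using bound
    by (intro bounded_linear_intro[of _ K])
      (auto simp: add scaleR_scaleC scale scaleC_complex_def mult.commute)
  have eq: "blinfun_of_cdual (Abs_cdual (Blinfun g)) = Blinfun g"
    by (rule Abs_cdual_inverse) (simp add: bounded_linear_Blinfun_apply[OF g] scale)
  have "norm (Blinfun g) \<le> K"
    by (rule norm_blinfun_bound[OF K]) (simp add: bounded_linear_Blinfun_apply[OF g] bound)
  then show ?thesis
    by (intro exI[of _ "Abs_cdual (Blinfun g)"])
      (simp add: cdual_apply.rep_eq norm_cdual.rep_eq eq bounded_linear_Blinfun_apply[OF g])
qed

text \<open>The choice is unambiguous, since a functional is determined by its values; the norm
  bound is put into the predicate so that it comes along with the evaluation rule.\<close>

definition bidual_embed :: "'a::complex_normed_vector \<Rightarrow> 'a cdual cdual"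
  where "bidual_embed x = (SOME z. (\<forall>y. cdual_apply z y = cdual_apply y x) \<and> norm z \<le> norm x)"

lemma
  shows cdual_apply_bidual_embed: "cdual_apply (bidual_embed x) y = cdual_apply y x"
    and norm_bidual_embed_le: "norm (bidual_embed x) \<le> norm x"
proof -
  have "\<exists>z. (\<forall>y. cdual_apply z y = cdual_apply y x) \<and> norm z \<le> norm x"
    by (rule cdual_existence)
      (auto simp: cdual_apply_add_left cdual_apply_scaleC_left mult.commute[of "norm x"]
        norm_cdual_apply_le)
  from someI_ex[OF this]
  show "cdual_apply (bidual_embed x) y = cdual_apply y x" "norm (bidual_embed x) \<le> norm x"
    unfolding bidual_embed_def by blast+
qed

lemma cdual_eqI: "(\<And>x. cdual_apply y x = cdual_apply z x) \<Longrightarrow> y = z"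
  by transfer (rule blinfun_eqI)

lemma bidual_embed_add: "bidual_embed (x + y) = bidual_embed x + bidual_embed y"
  by (rule cdual_eqI)
    (simp add: cdual_apply_bidual_embed cdual_apply_add_left
      linear_add[OF bounded_linear.linear[OF bounded_linear_cdual_apply]])

lemma bidual_embed_scaleC: "bidual_embed (c *\<^sub>C x) = c *\<^sub>C bidual_embed x"
  by (rule cdual_eqI)
    (simp add: cdual_apply_bidual_embed cdual_apply_scaleC_left cdual_apply_scaleC)

text \<open>The functional \<open>\<psi>\<close> is the composition of \<open>\<phi>\<close> with
  \<open>bidual_embed\<close>, two linear maps that do not increase norms.\<close>

lemma cdual_apply_bidual_embed_restrict:
  fixes \<phi> :: "'a::complex_normed_vector cdual cdual cdual"
  assumes "\<phi> \<in> cball 0 1"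
  obtains \<psi> :: "'a cdual"
  where "\<psi> \<in> cball 0 1" "\<And>x. cdual_apply \<phi> (bidual_embed x) = cdual_apply \<psi> x"
proof -
  have "cmod (cdual_apply \<phi> (bidual_embed x)) \<le> 1 * norm x" for x
  proof -
    have "cmod (cdual_apply \<phi> (bidual_embed x)) \<le> norm \<phi> * norm (bidual_embed x)"
      by (rule norm_cdual_apply_le)
    also have "\<dots> \<le> 1 * norm x"
      using assms by (intro mult_mono norm_bidual_embed_le) auto
    finally show ?thesis .
  qed
  then have "\<exists>\<psi>. (\<forall>x. cdual_apply \<psi> x = cdual_apply \<phi> (bidual_embed x)) \<and> norm \<psi> \<le> 1"
    by (intro cdual_existence)
      (auto simp: bidual_embed_add bidual_embed_scaleC cdual_apply_scaleC
        linear_add[OF bounded_linear.linear[OF bounded_linear_cdual_apply]])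
  then show ?thesis using that by auto
qed

section \<open>Weakly p-summable sequences\<close>

lemma
  fixes xs :: "nat \<Rightarrow> 'a::complex_normed_vector"
  assumes xs: "xs \<in> weak_lp p"
  shows weak_lp_bidual_embed: "(\<lambda>n. bidual_embed (xs n)) \<in> weak_lp p"
    and weak_lp_norm_bidual_embed_le:
      "weak_lp_norm p (\<lambda>n. bidual_embed (xs n)) \<le> weak_lp_norm p xs"
proof -
  have lp: "(\<lambda>n. cdual_apply \<psi> (xs n)) \<in> lp p" if "\<psi> \<in> cball 0 1" for \<psi>
    using xs that unfolding weak_lp_def by blast
  have bdd: "bdd_above ((\<lambda>\<psi>. lp_norm p (\<lambda>n. cdual_apply \<psi> (xs n))) ` cball 0 1)"
    using xs by (simp add: weak_lp_def)
  \<comment> \<open>Every scalar sequence that \<open>\<phi>\<close> produces is already produced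
    from \<open>xs\<close> by some \<open>\<psi>\<close> in the unit ball of the dual, so the new
    supremum runs over no new values.\<close>
  have lp': "(\<lambda>n. cdual_apply \<phi> (bidual_embed (xs n))) \<in> lp p"
    and le: "lp_norm p (\<lambda>n. cdual_apply \<phi> (bidual_embed (xs n))) \<le> weak_lp_norm p xs"
    if \<phi>: "\<phi> \<in> cball 0 1" for \<phi>
  proof -
    obtain \<psi> :: "'a cdual" where \<psi>: "\<psi> \<in> cball 0 1"
      "\<And>x. cdual_apply \<phi> (bidual_embed x) = cdual_apply \<psi> x"
      using cdual_apply_bidual_embed_restrict[OF \<phi>] by blast
    show "(\<lambda>n. cdual_apply \<phi> (bidual_embed (xs n))) \<in> lp p"
      using lp[OF \<psi>(1)] by (simp add: \<psi>(2))
    show "lp_norm p (\<lambda>n. cdual_apply \<phi> (bidual_embed (xs n))) \<le> weak_lp_norm p xs"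
      unfolding \<psi>(2) weak_lp_norm_def by (rule cSUP_upper[OF \<psi>(1) bdd])
  qed
  show "(\<lambda>n. bidual_embed (xs n)) \<in> weak_lp p"
    unfolding weak_lp_def by (intro CollectI conjI ballI lp' bdd_aboveI2[OF le])
  show "weak_lp_norm p (\<lambda>n. bidual_embed (xs n)) \<le> weak_lp_norm p xs"
    unfolding weak_lp_norm_def[of p "\<lambda>n. bidual_embed (xs n)"]
    by (intro cSUP_least le) auto
qed

text \<open>The zero functional lies in the unit ball and contributes a nonnegative value. This
  supplies the lower bound 0 for the set whose infimum is \<open>QNwp_norm\<close>.\<close>

lemma weak_lp_norm_nonneg:
  fixes xs :: "nat \<Rightarrow> 'a::complex_normed_vector"
  assumes "xs \<in> weak_lp p"
  shows "0 \<le> weak_lp_norm p xs"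
proof -
  have "bdd_above ((\<lambda>\<psi>. lp_norm p (\<lambda>n. cdual_apply \<psi> (xs n))) ` cball 0 1)"
    using assms by (simp add: weak_lp_def)
  then have "lp_norm p (\<lambda>n. cdual_apply 0 (xs n)) \<le> weak_lp_norm p xs"
    unfolding weak_lp_norm_def by (intro cSUP_upper) auto
  moreover have "0 \<le> lp_norm p (\<lambda>n. cdual_apply 0 (xs n))"
    by (simp add: lp_norm_def)
  ultimately show ?thesis by linarith
qed

text \<open>\<open>weak_lp\<close> only speaks of the unit ball, while domination concerns every
  \<open>y\<close>; a nonzero \<open>y\<close> is rescaled to norm 1.\<close>

lemma weak_lp_cdual_apply_lp:
  fixes xs :: "nat \<Rightarrow> 'a::complex_normed_vector"
  assumes xs: "xs \<in> weak_lp p"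
  shows "(\<lambda>n. cdual_apply y (xs n)) \<in> lp p"
proof (cases "y = 0")
  case True
  then show ?thesis by (simp add: lp_def cdual_apply_zero_left)
next
  case False
  define c where "c = complex_of_real (inverse (norm y))"
  have "c *\<^sub>C y \<in> cball 0 1"
    using False by (simp add: norm_scaleC c_def norm_inverse)
  then have "(\<lambda>n. cdual_apply (c *\<^sub>C y) (xs n)) \<in> lp p"
    using xs unfolding weak_lp_def by blast
  then have "summable (\<lambda>n. cmod c powr p * cmod (cdual_apply y (xs n)) powr p)"
    by (simp add: lp_def cdual_apply_scaleC_left norm_mult powr_mult)
  moreover have "cmod c powr p \<noteq> 0"
    using False by (simp add: c_def)
  ultimately have "summable (\<lambda>n. cmod (cdual_apply y (xs n)) powr p)"
    by (rule summable_mult_D)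
  then show ?thesis
    by (simp add: lp_def)
qed

section \<open>Functionals on p-convex hulls\<close>

lemma conj_index_gt_1: "1 < p \<Longrightarrow> 1 < conj_index p"
  by (simp add: conj_index_def)

lemma inverse_conj_index: "1 < p \<Longrightarrow> 1 / p + 1 / conj_index p = 1"
  by (simp add: conj_index_def field_simps)

lemma cdual_apply_p_conv_le:
  fixes xs :: "nat \<Rightarrow> 'a::complex_normed_vector"
  assumes p: "1 < p" and xs: "xs \<in> weak_lp p" and z: "z \<in> p_conv p xs"
  shows "cmod (cdual_apply y z) \<le> lp_norm p (\<lambda>n. cdual_apply y (xs n))"
proof -
  from z obtain a where a: "a \<in> lp (conj_index p)" "lp_norm (conj_index p) a \<le> 1"
    "(\<lambda>n. a n *\<^sub>C xs n) sums z"
    unfolding p_conv_def by blast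
  have b: "summable (\<lambda>n. cmod (cdual_apply y (xs n)) powr p)"
    using weak_lp_cdual_apply_lp[OF xs] by (simp add: lp_def)
  have sa: "summable (\<lambda>n. cmod (a n) powr conj_index p)"
    using a(1) by (simp add: lp_def)
  note Holder = p conj_index_gt_1[OF p] inverse_conj_index[OF p] norm_ge_zero norm_ge_zero b sa
  have "(\<lambda>n. a n * cdual_apply y (xs n)) sums cdual_apply y z"
    using bounded_linear.sums[OF bounded_linear_cdual_apply[of y] a(3)]
    by (simp add: cdual_apply_scaleC)
  then have "cmod (cdual_apply y z) = cmod (\<Sum>n. a n * cdual_apply y (xs n))"
    by (simp add: sums_iff)
  \<comment> \<open>The triangle inequality for series requires absolute convergence, which is the
    summability half of Hoelder's inequality.\<close>
  also have "\<dots> \<le> (\<Sum>n. cmod (a n * cdual_apply y (xs n)))"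
    using summable_Holder[OF Holder] by (intro summable_norm) (simp add: norm_mult mult.commute)
  also have "\<dots> = (\<Sum>n. cmod (cdual_apply y (xs n)) * cmod (a n))"
    by (simp add: norm_mult mult.commute)
  also have "\<dots> \<le> lp_norm p (\<lambda>n. cdual_apply y (xs n)) * lp_norm (conj_index p) a"
    unfolding lp_norm_def by (rule suminf_Holder[OF Holder])
  also have "\<dots> \<le> lp_norm p (\<lambda>n. cdual_apply y (xs n))"
    using a(2) by (intro mult_left_le) (auto simp: lp_norm_def)
  finally show ?thesis .
qed

section \<open>Weighted norms and the transpose operator\<close>

lemma weighted_norm_le:
  assumes "0 \<le> C" "\<And>x. x \<in> U \<Longrightarrow> v x * norm (g x) \<le> C"
  shows "weighted_norm U v g \<le> C"
  unfolding weighted_norm_def using assms by (intro cSup_least) auto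

lemma holomorphic_map_on_transpose:
  assumes "holomorphic_map_on U f"
  shows "holomorphic_map_on U (transpose_map f y)"
  unfolding holomorphic_map_on_def
proof
  fix x assume "x \<in> U"
  then obtain D where D: "(f has_derivative D) (at x)" "\<And>c h. D (c *\<^sub>C h) = c *\<^sub>C D h"
    using assms unfolding holomorphic_map_on_def by blast
  have "(transpose_map f y has_derivative (\<lambda>h. cdual_apply y (D h))) (at x)"
    unfolding transpose_map_def o_def
    by (rule bounded_linear.has_derivative[OF bounded_linear_cdual_apply D(1)])
  then show "\<exists>D. (transpose_map f y has_derivative D) (at x) \<and>
      (\<forall>c h. D (c *\<^sub>C h) = c *\<^sub>C D h)"
    by (intro exI[of _ "\<lambda>h. cdual_apply y (D h)"])
      (simp add: D(2) cdual_apply_scaleC scaleC_complex_def)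
qed

lemma bounded_clinear_into_transpose:
  assumes f: "f \<in> Hv U v" and v: "\<And>x. x \<in> U \<Longrightarrow> 0 \<le> v x"
  shows "bounded_clinear_into (Hv U v) (weighted_norm U v) (transpose_map f)"
proof -
  from f obtain M where M: "\<And>x. x \<in> U \<Longrightarrow> v x * norm (f x) \<le> M"
    unfolding Hv_def bdd_above_def by blast
  \<comment> \<open>For empty \<open>U\<close> the bound \<open>M\<close> may be negative;
    \<open>max 0 M\<close> gives the nonnegative constant that \<open>weighted_norm_le\<close> asks
    for.\<close>
  have bound: "v x * cmod (transpose_map f y x) \<le> max 0 M * norm y" if "x \<in> U" for x y
  proof -
    have "v x * cmod (transpose_map f y x) \<le> v x * (norm y * norm (f x))"
      using v[OF that] by (simp add: transpose_map_def mult_left_mono norm_cdual_apply_le)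
    also have "\<dots> = (v x * norm (f x)) * norm y"
      by simp
    also have "\<dots> \<le> max 0 M * norm y"
      using M[OF that] by (intro mult_right_mono) auto
    finally show ?thesis .
  qed
  have "transpose_map f y \<in> Hv U v" for y
  proof -
    have "holomorphic_map_on U (transpose_map f y)"
      using f by (intro holomorphic_map_on_transpose) (simp add: Hv_def)
    moreover have "transpose_map f y x = 0" if "x \<notin> U" for x
      using f that by (simp add: Hv_def transpose_map_def
          linear_0[OF bounded_linear.linear[OF bounded_linear_cdual_apply]])
    moreover have "bdd_above ((\<lambda>x. v x * cmod (transpose_map f y x)) ` U)"
      by (rule bdd_aboveI2[OF bound])
    ultimately show ?thesis
      by (simp add: Hv_def)
  qed
  moreover have "transpose_map f (y + z) = transpose_map f y + transpose_map f z" for y z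
    by (simp add: transpose_map_def fun_eq_iff cdual_apply_add_left)
  moreover have "transpose_map f (c *\<^sub>C y) = c *\<^sub>C transpose_map f y" for c y
    by (simp add: transpose_map_def fun_eq_iff cdual_apply_scaleC_left scaleC_fun_def
        scaleC_complex_def)
  moreover have "weighted_norm U v (transpose_map f y) \<le> max 0 M * norm y" for y
    by (rule weighted_norm_le) (simp_all add: bound)
  ultimately show ?thesis
    unfolding bounded_clinear_into_def by (intro conjI allI exI)
qed

lemma bidual_embed_QNwp_dominating:
  assumes p: "1 < p" and xs: "xs \<in> weak_lp p"
    and conv: "(\<lambda>x. v x *\<^sub>R f x) ` U \<subseteq> p_conv p xs"
    and v: "\<And>x. x \<in> U \<Longrightarrow> 0 \<le> v x"
  shows "(\<lambda>n. bidual_embed (xs n)) \<in> QNwp_dominating p (weighted_norm U v) (transpose_map f)"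
proof -
  have "weighted_norm U v (transpose_map f y) \<le> lp_norm p (\<lambda>n. cdual_apply y (xs n))" for y
  proof (rule weighted_norm_le)
    show "0 \<le> lp_norm p (\<lambda>n. cdual_apply y (xs n))"
      by (simp add: lp_norm_def)
    fix x assume x: "x \<in> U"
    \<comment> \<open>The nonnegative weight moves through the modulus and through \<open>y\<close>,
      which turns the left-hand side into the value of \<open>y\<close> at a point of the
      hull.\<close>
    have "v x * cmod (transpose_map f y x) = cmod (cdual_apply y (v x *\<^sub>R f x))"
      using v[OF x] by (simp add: transpose_map_def scaleR_scaleC cdual_apply_scaleC norm_mult)
    also have "\<dots> \<le> lp_norm p (\<lambda>n. cdual_apply y (xs n))"
      using conv x by (intro cdual_apply_p_conv_le[OF p xs]) auto
    finally show "v x * norm (transpose_map f y x) \<le> lp_norm p (\<lambda>n. cdual_apply y (xs n))" .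
  qed
  then show ?thesis
    using weak_lp_bidual_embed[OF xs]
    by (simp add: QNwp_dominating_def cdual_apply_bidual_embed lp_norm_def)
qed

theorem corollary2p16:
  fixes U :: "'e::complex_banach set"
    and v :: "'e \<Rightarrow> real"
    and p :: real
    and f :: "'e \<Rightarrow> 'f::complex_banach"
  assumes "open U"
    and "weight_on U v"
    and "1 < p"
    and "f \<in> HvKwp p U v"
  shows "transpose_map f \<in> QNwp p (Hv U v) (weighted_norm U v) \<and>
    QNwp_norm p (weighted_norm U v) (transpose_map f) \<le> HvKwp_norm p U v f"
proof -
  have v: "0 \<le> v x" if "x \<in> U" for x
    using assms(2) that by (simp add: weight_on_def less_imp_le)
  have f: "f \<in> Hv U v" and "rel_weakly_p_compact p ((\<lambda>x. v x *\<^sub>R f x) ` U)"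
    using assms(4) by (auto simp: HvKwp_def)
  then obtain xs where xs: "xs \<in> weak_lp p" "(\<lambda>x. v x *\<^sub>R f x) ` U \<subseteq> p_conv p xs"
    unfolding rel_weakly_p_compact_def by blast
  note dom = bidual_embed_QNwp_dominating[OF assms(3) _ _ v]
  have "transpose_map f \<in> QNwp p (Hv U v) (weighted_norm U v)"
    using bounded_clinear_into_transpose[OF f v] dom[OF xs] unfolding QNwp_def by blast
  moreover have "QNwp_norm p (weighted_norm U v) (transpose_map f) \<le> HvKwp_norm p U v f"
    unfolding HvKwp_norm_def m_Kwp_def
  proof (rule cInf_greatest)
    show "{weak_lp_norm p xs |xs. xs \<in> weak_lp p \<and>
        (\<lambda>x. v x *\<^sub>R f x) ` U \<subseteq> p_conv p xs} \<noteq> {}"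
      using xs by blast
    fix r assume "r \<in> {weak_lp_norm p xs |xs. xs \<in> weak_lp p \<and>
        (\<lambda>x. v x *\<^sub>R f x) ` U \<subseteq> p_conv p xs}"
    then obtain ys where ys: "ys \<in> weak_lp p" "(\<lambda>x. v x *\<^sub>R f x) ` U \<subseteq> p_conv p ys"
      and r: "r = weak_lp_norm p ys"
      by blast
    have "QNwp_norm p (weighted_norm U v) (transpose_map f) \<le>
        weak_lp_norm p (\<lambda>n. bidual_embed (ys n))"
      unfolding QNwp_norm_def
      by (intro cInf_lower imageI dom[OF ys] bdd_belowI2[of _ 0] weak_lp_norm_nonneg)
        (auto simp: QNwp_dominating_def)
    also have "\<dots> \<le> r"
      unfolding r by (rule weak_lp_norm_bidual_embed_le[OF ys(1)])
    finally show "QNwp_norm p (weighted_norm U v) (transpose_map f) \<le> r" .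
  qed
  ultimately show ?thesis by blast
qed

end
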